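(* Let $G$ be a nontrivial connected graph and let $w$ be a vertex of $G$. For nonnegative integers $p$ and $q$, let $G(p,q)$ denote the graph obtained from $G$ by attaching to $w$ two pendent paths $P = w v_1 v_2 \ldots v_p$ and $Q = w u_1 u_2 \ldots u_q$ of lengths $p$ and $q$ respectively (the vertices $v_i, u_j$ being new vertices). If $p \geq q \geq 1$, then $$ecc(G(p,q)) < ecc(G(p+1,q-1)).$$
   Context: All graphs are finite, simple and connected. For a connected graph $H$ on vertex set $V$ with $|V|=n$, the eccentricity of a vertex $v$ is $\varepsilon(v)=\max_{u\in V} d(u,v)$, where $d$ is the shortest-path distance, and the average eccentricity is $ecc(H)=\frac{1}{n}\sum_{v\in V}\varepsilon(v)$. *)

theory Defs
  imports "Graph_Theory.Graph_Theory"
begin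

text \<open>
  A finite simple graph is a \<^locale>\<open>pair_graph\<close>: each edge is represented by its two
  opposite arcs. The distance is the library's weighted distance for unit weights; it is
  an extended real, which is finite on connected graphs (see \<open>graph_dist_eq_Least\<close>).
\<close>

definition graph_dist :: "('a, 'b) pre_digraph \<Rightarrow> 'a \<Rightarrow> 'a \<Rightarrow> real" where
  "graph_dist H u v = real_of_ereal (wf_digraph.\<mu> H (\<lambda>_. 1) u v)"

definition eccentricity :: "('a, 'b) pre_digraph \<Rightarrow> 'a \<Rightarrow> real" where
  "eccentricity H v = Max ((\<lambda>u. graph_dist H u v) ` verts H)"

definition ecc :: "('a, 'b) pre_digraph \<Rightarrow> real" where
  "ecc H = (1 / real (card (verts H))) * (\<Sum>v\<in>verts H. eccentricity H v)"

datatype 'a pendent_vertex = Base 'a | NewV nat | NewU nat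

definition pendent_path :: "(nat \<Rightarrow> 'a pendent_vertex) \<Rightarrow> 'a \<Rightarrow> nat \<Rightarrow> 'a pendent_vertex list" where
  "pendent_path X w k = Base w # map X [1..<Suc k]"

text \<open>
  \<open>attach_paths G w p q\<close> is $G(p,q)$: the vertices \<open>NewV 1, \<dots>, NewV p\<close> and
  \<open>NewU 1, \<dots>, NewU q\<close> are new by construction, and \<open>vwalk_arcs\<close> lists the pairs of consecutive vertices of a path.
\<close>

definition attach_paths ::
    "'a pair_pre_digraph \<Rightarrow> 'a \<Rightarrow> nat \<Rightarrow> nat \<Rightarrow> 'a pendent_vertex pair_pre_digraph" where
  "attach_paths G w p q =
    (let E = set (vwalk_arcs (pendent_path NewV w p)) \<union> set (vwalk_arcs (pendent_path NewU w q))
     in \<lparr> pverts = Base ` pverts G \<union> NewV ` {1..p} \<union> NewU ` {1..q},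
          parcs = map_prod Base Base ` parcs G \<union> E \<union> E\<inverse> \<rparr>)"

lemma (in wf_digraph) graph_dist_eq_Least:
  assumes "u \<rightarrow>\<^sup>*\<^bsub>G\<^esub> v"
  shows "graph_dist G u v = real (LEAST n. \<exists>p. awalk u p v \<and> length p = n)"
proof -
  define n where "n = (LEAST n. \<exists>p. awalk u p v \<and> length p = n)"
  have cost: "awalk_cost (\<lambda>_. 1) p = real (length p)" for p :: "'b list"
    by (induct p) auto
  obtain p0 where "awalk u p0 v"
    using assms by (auto simp: reachable_awalk)
  then have "\<exists>n p. awalk u p v \<and> length p = n" by blast
  then have "\<exists>p. awalk u p v \<and> length p = n"
    unfolding n_def by (rule LeastI_ex)
  then obtain p where p: "awalk u p v" "length p = n" by blast
  have le: "n \<le> length r" if "awalk u r v" for r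
    unfolding n_def by (rule Least_le) (use that in blast)
  have "\<mu> (\<lambda>_. 1) u v = ereal (real n)"
    unfolding \<mu>_def
  proof (rule antisym)
    show "(INF p\<in>{p. awalk u p v}. ereal (awalk_cost (\<lambda>_. 1) p)) \<le> ereal (real n)"
      by (rule INF_lower2[of p]) (use p in \<open>auto simp: cost\<close>)
    show "ereal (real n) \<le> (INF p\<in>{p. awalk u p v}. ereal (awalk_cost (\<lambda>_. 1) p))"
      by (rule INF_greatest) (use le in \<open>auto simp: cost\<close>)
  qed
  then show ?thesis by (simp add: graph_dist_def n_def)
qed

lemma set_vwalk_arcs_pendent_path:
  "set (vwalk_arcs (pendent_path X w k)) =
    (\<lambda>i. (if i = 0 then Base w else X i, X (Suc i))) ` {..<k}"
proof (induct k)
  case 0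
  then show ?case by (simp add: pendent_path_def)
next
  case (Suc k)
  have app: "xs \<noteq> [] \<Longrightarrow> set (vwalk_arcs (xs @ [x])) = insert (last xs, x) (set (vwalk_arcs xs))"
    for xs and x :: "'a pendent_vertex"
    by (induct xs rule: vwalk_arcs.induct) auto
  have "pendent_path X w (Suc k) = pendent_path X w k @ [X (Suc k)]"
    by (simp add: pendent_path_def)
  moreover have "last (pendent_path X w k) = (if k = 0 then Base w else X k)"
    by (simp add: pendent_path_def)
  moreover have "pendent_path X w k \<noteq> []"
    by (simp add: pendent_path_def)
  ultimately show ?case
    using Suc by (simp add: app lessThan_Suc)
qed

lemma pair_graph_attach_paths:
  assumes "pair_graph G" and "w \<in> pverts G"
  shows "pair_graph (attach_paths G w p q)"
proof -
  interpret pair_graph G by fact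
  have sym: "(y, x) \<in> parcs G" if "(x, y) \<in> parcs G" for x y
    using that arcs_symmetric by auto
  let ?H = "attach_paths G w p q"
  have fin: "finite (parcs ?H)"
    by (auto simp: attach_paths_def Let_def)
  show ?thesis
  proof
    show "finite (parcs ?H)" by (fact fin)
    show "finite (pverts ?H)" by (auto simp: attach_paths_def Let_def)
    show "symmetric ?H"
      unfolding symmetric_def with_proj_simps
      by (rule symI) (auto simp: attach_paths_def Let_def dest: sym)
  next
    fix e assume e: "e \<in> parcs ?H"
    show "fst e \<in> pverts ?H" "snd e \<in> pverts ?H"
      using e assms(2) wellformed'
      by (auto simp: attach_paths_def Let_def set_vwalk_arcs_pendent_path)
    show "fst e \<noteq> snd e"
      using e pair_no_loops
      by (auto simp: attach_paths_def Let_def set_vwalk_arcs_pendent_path split: if_splits)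
  qed
qed

lemma connected_attach_paths:
  assumes "pair_graph G" and "connected G" and "w \<in> pverts G"
  shows "connected (attach_paths G w p q)"
proof -
  interpret pair_graph G by fact
  let ?H = "attach_paths G w p q"
  interpret H: pair_graph ?H
    by (rule pair_graph_attach_paths) fact+
  have symH: "symmetric ?H" by (rule H.pair_sym_arcs)
  have w: "Base w \<in> pverts ?H"
    using assms(3) by (simp add: attach_paths_def Let_def)
  have base: "Base w \<rightarrow>\<^sup>*\<^bsub>?H\<^esub> Base x" if "x \<in> pverts G" for x
  proof -
    have "w \<rightarrow>\<^sup>*\<^bsub>with_proj G\<^esub> x"
      using assms(2,3) that reachable_mk_symmetric_eq[OF pair_sym_arcs]
      by (auto simp: connected_def strongly_connected_def)
    then show ?thesis
    proof (induct rule: reachable_induct)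
      case base
      then show ?case using w by simp
    next
      case (step x y)
      from step(2) have "(Base x, Base y) \<in> parcs ?H"
        by (auto simp: attach_paths_def Let_def)
      with step(3) show ?case
        by (auto intro: H.reachable_adj_trans)
    qed
  qed
  have V: "Base w \<rightarrow>\<^sup>*\<^bsub>?H\<^esub> (if i = 0 then Base w else NewV i)" if "i \<le> p" for i
    using that
  proof (induct i)
    case (Suc i)
    have "(if i = 0 then Base w else NewV i, NewV (Suc i)) \<in> parcs ?H"
      using Suc(2) by (auto simp: attach_paths_def Let_def set_vwalk_arcs_pendent_path)
    with Suc show ?case
      by (auto intro: H.reachable_adj_trans)
  qed (use w in simp)
  have U: "Base w \<rightarrow>\<^sup>*\<^bsub>?H\<^esub> (if i = 0 then Base w else NewU i)" if "i \<le> q" for i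
    using that
  proof (induct i)
    case (Suc i)
    have "(if i = 0 then Base w else NewU i, NewU (Suc i)) \<in> parcs ?H"
      using Suc(2) by (auto simp: attach_paths_def Let_def set_vwalk_arcs_pendent_path)
    with Suc show ?case
      by (auto intro: H.reachable_adj_trans)
  qed (use w in simp)
  have all: "Base w \<rightarrow>\<^sup>*\<^bsub>?H\<^esub> x" if "x \<in> pverts ?H" for x
  proof -
    from that consider y where "x = Base y" "y \<in> pverts G"
      | i where "x = NewV i" "1 \<le> i" "i \<le> p" | i where "x = NewU i" "1 \<le> i" "i \<le> q"
      by (auto simp: attach_paths_def Let_def)
    then show ?thesis
      using base V U by cases (force split: if_splits)+
  qed
  have "x \<rightarrow>\<^sup>*\<^bsub>?H\<^esub> y" if "x \<in> pverts ?H" "y \<in> pverts ?H" for x y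
    using H.reachable_trans[OF symmetric_reachable[OF symH all[OF that(1)]] all[OF that(2)]] .
  then show ?thesis
    using w H.reachable_mk_symmetric_eq[OF symH]
    by (auto simp: connected_def strongly_connected_def)
qed

end

theory Submission
  imports Defs
begin

text \<open>
  Both graphs have the same number of vertices, so it suffices to find a bijection between their
  vertex sets that never decreases the eccentricity and increases it somewhere. Let $e$ be the
  eccentricity of $w$ in $G$. If $q \le e$, send $u_q$ to $v_{p+1}$ and fix everything else.
  If $q > e$, the eccentricities along the path $v_p \ldots w \ldots u_q$ are those of a path on
  $p+q+1$ vertices; shifting this path by one step preserves them, while every
  vertex of $G$ other than $w$ gains one.
\<close>

section \<open>Distances in a digraph, and certificates for them\<close>

text \<open>By \<open>graph_dist_eq_Least\<close>, this is \<open>graph_dist\<close> on reachable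
  pairs, but with values in the natural numbers. It measures distances inside the given graph;
  distances in the enlarged graphs are obtained from explicit formulas instead.\<close>

definition hop_dist :: "('a, 'b) pre_digraph \<Rightarrow> 'a \<Rightarrow> 'a \<Rightarrow> nat" where
  "hop_dist G u v = (LEAST n. \<exists>p. pre_digraph.awalk G u p v \<and> length p = n)"

context wf_digraph
begin

lemma hop_dist_le: "awalk u p v \<Longrightarrow> hop_dist G u v \<le> length p"
  unfolding hop_dist_def by (rule Least_le) blast

lemma hop_dist_awalk:
  assumes "u \<rightarrow>\<^sup>*\<^bsub>G\<^esub> v"
  obtains p where "awalk u p v" "length p = hop_dist G u v"
proof -
  have "\<exists>n p. awalk u p v \<and> length p = n"
    using assms by (auto simp: reachable_awalk)
  then have "\<exists>p. awalk u p v \<and> length p = hop_dist G u v"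
    unfolding hop_dist_def by (rule LeastI_ex)
  then show thesis using that by blast
qed

lemma hop_dist_self: "v \<in> verts G \<Longrightarrow> hop_dist G v v = 0"
  using hop_dist_le[of v "[]" v] by (simp add: awalk_Nil_iff)

lemma hop_dist_triangle:
  assumes "u \<rightarrow>\<^sup>*\<^bsub>G\<^esub> v" "v \<rightarrow>\<^sup>*\<^bsub>G\<^esub> z"
  shows "hop_dist G u z \<le> hop_dist G u v + hop_dist G v z"
  by (metis assms awalk_appendI hop_dist_awalk hop_dist_le length_append)

lemma hop_dist_adj:
  assumes "x \<rightarrow>\<^bsub>G\<^esub> y" "y \<rightarrow>\<^sup>*\<^bsub>G\<^esub> v"
  shows "hop_dist G x v \<le> Suc (hop_dist G y v)"
proof -
  obtain p where p: "awalk y p v" "length p = hop_dist G y v"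
    using hop_dist_awalk[OF assms(2)] .
  obtain a where "a \<in> arcs G" "tail G a = x" "head G a = y"
    using assms(1) by (auto simp: arcs_ends_def arc_to_ends_def)
  then have "awalk x (a # p) v"
    using p(1) by (simp add: awalk_Cons_iff)
  from hop_dist_le[OF this] p(2) show ?thesis by simp
qed

text \<open>Take the second vertex of a shortest walk: the rest of the walk bounds its distance from
  above, and \<open>hop_dist_adj\<close> bounds it from below.\<close>

lemma hop_dist_pred:
  assumes "x \<rightarrow>\<^sup>*\<^bsub>G\<^esub> v" "x \<noteq> v"
  shows "\<exists>y. x \<rightarrow>\<^bsub>G\<^esub> y \<and> hop_dist G x v = Suc (hop_dist G y v)"
proof -
  obtain p where p: "awalk x p v" "length p = hop_dist G x v"
    using hop_dist_awalk[OF assms(1)] .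
  then obtain a r where r: "p = a # r"
    using assms(2) by (cases p) (auto simp: awalk_Nil_iff)
  with p have a: "a \<in> arcs G" "tail G a = x" and w: "awalk (head G a) r v"
    by (auto simp: awalk_Cons_iff)
  have adj: "x \<rightarrow>\<^bsub>G\<^esub> head G a"
    using a by (auto intro: in_arcs_imp_in_arcs_ends)
  have "hop_dist G x v \<le> Suc (hop_dist G (head G a) v)"
    using hop_dist_adj[OF adj] w by (auto simp: reachable_awalk)
  moreover have "hop_dist G (head G a) v \<le> length r"
    using w by (rule hop_dist_le)
  ultimately show ?thesis using adj p(2) r by auto
qed

text \<open>A local certificate for distances to \<open>v\<close>. Since \<open>D\<close> drops by
  at most one along an arc and ends at 0, no walk to \<open>v\<close> is shorter than
  \<open>D\<close>; following arcs along which \<open>D\<close> drops by exactly one yields a walk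
  of that length. Guessed distance formulas can thus be checked arc by arc.\<close>

lemma graph_dist_eqI:
  fixes D :: "'a \<Rightarrow> nat"
  assumes target: "D v = 0" "v \<in> verts G"
    and lipschitz: "\<And>x y. x \<rightarrow>\<^bsub>G\<^esub> y \<Longrightarrow> D x \<le> Suc (D y)"
    and descent: "\<And>x. x \<in> verts G \<Longrightarrow> x \<noteq> v \<Longrightarrow> \<exists>y. x \<rightarrow>\<^bsub>G\<^esub> y \<and> D x = Suc (D y)"
    and "u \<in> verts G"
  shows "graph_dist G u v = D u"
proof -
  have lower: "D x \<le> length p" if "awalk x p v" for x p
    using that
  proof (induct p arbitrary: x)
    case Nil
    then show ?case using target by (simp add: awalk_Nil_iff)
  next
    case (Cons a p)
    then have "x \<rightarrow>\<^bsub>G\<^esub> head G a" "awalk (head G a) p v"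
      by (auto simp: awalk_Cons_iff intro: in_arcs_imp_in_arcs_ends)
    then show ?case using Cons(1) lipschitz by fastforce
  qed
  have upper: "\<exists>p. awalk x p v \<and> length p = n" if "x \<in> verts G" "D x = n" for x n
    using that
  proof (induct n arbitrary: x)
    case 0
    then have "x = v" using descent by fastforce
    then show ?case using target by (auto simp: awalk_Nil_iff)
  next
    case (Suc n)
    then obtain y where y: "x \<rightarrow>\<^bsub>G\<^esub> y" "D y = n"
      using descent target by (metis nat.distinct(1) nat.inject)
    then obtain p where p: "awalk y p v" "length p = n"
      using Suc(1) adj_in_verts by blast
    obtain a where "a \<in> arcs G" "tail G a = x" "head G a = y"
      using y by (auto simp: arcs_ends_def arc_to_ends_def)
    then have "awalk x (a # p) v"
      using p(1) by (simp add: awalk_Cons_iff)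
    then show ?case using p(2) by (metis length_Cons)
  qed
  obtain p where p: "awalk u p v" "length p = D u"
    using upper \<open>u \<in> verts G\<close> by blast
  have "(LEAST n. \<exists>p. awalk u p v \<and> length p = n) = D u"
    by (rule Least_equality) (use p lower in auto)
  then show ?thesis
    using graph_dist_eq_Least p(1) by (metis reachable_awalk)
qed

lemma eccentricity_eqI:
  fixes D :: "'a \<Rightarrow> nat"
  assumes fin: "finite (verts G)"
    and target: "D v = 0" "v \<in> verts G"
    and lipschitz: "\<And>x y. x \<rightarrow>\<^bsub>G\<^esub> y \<Longrightarrow> D x \<le> Suc (D y)"
    and descent: "\<And>x. x \<in> verts G \<Longrightarrow> x \<noteq> v \<Longrightarrow> \<exists>y. x \<rightarrow>\<^bsub>G\<^esub> y \<and> D x = Suc (D y)"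
    and bound: "\<And>x. x \<in> verts G \<Longrightarrow> D x \<le> m"
    and attained: "\<exists>x \<in> verts G. D x = m"
  shows "eccentricity G v = m"
proof -
  have "(\<lambda>u. graph_dist G u v) ` verts G = (\<lambda>u. real (D u)) ` verts G"
    using graph_dist_eqI[of D, OF target lipschitz descent] by (intro image_cong) auto
  moreover have "Max ((\<lambda>u. real (D u)) ` verts G) = m"
    using fin bound attained by (intro Max_eqI) auto
  ultimately show ?thesis unfolding eccentricity_def by simp
qed

end

lemma pverts_attach_paths:
  "pverts (attach_paths G w p q) = Base ` pverts G \<union> NewV ` {1..p} \<union> NewU ` {1..q}"
  by (simp add: attach_paths_def Let_def)

lemma in_pverts_attach_paths:
  "Base a \<in> pverts (attach_paths G w p q) \<longleftrightarrow> a \<in> pverts G"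
  "NewV i \<in> pverts (attach_paths G w p q) \<longleftrightarrow> 1 \<le> i \<and> i \<le> p"
  "NewU i \<in> pverts (attach_paths G w p q) \<longleftrightarrow> 1 \<le> i \<and> i \<le> q"
  by (auto simp: pverts_attach_paths)

text \<open>The two graphs to be compared have different vertex sets, so the sums of eccentricities
  are first brought to a common index set along \<open>h\<close>.\<close>

lemma sum_strict_mono_bij:
  fixes f g :: "'a \<Rightarrow> 'b :: ordered_cancel_comm_monoid_add"
  assumes "finite A" "bij_betw h A B"
    and "\<And>x. x \<in> A \<Longrightarrow> f x \<le> g (h x)" "\<exists>x\<in>A. f x < g (h x)"
  shows "sum f A < sum g B"
  using sum_strict_mono_ex1[of A f "g \<circ> h"] sum.reindex_bij_betw[OF assms(2), of g] assms
  by auto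

section \<open>Distances inside the rooted graph\<close>

locale rooted_graph = pair_graph G for G :: "'a pair_pre_digraph" +
  fixes w :: 'a
  assumes connected: "connected G" and root: "w \<in> pverts G"
begin

abbreviation d :: "'a \<Rightarrow> 'a \<Rightarrow> nat" where
  "d \<equiv> hop_dist (with_proj G)"

text \<open>The eccentricity within \<open>G\<close> alone. The eccentricity of a new vertex of the
  enlarged graph depends on \<open>G\<close> only through \<open>base_ecc w\<close>.\<close>

definition base_ecc :: "'a \<Rightarrow> nat" where
  "base_ecc x = Max ((\<lambda>y. d y x) ` pverts G)"

lemma reach: "x \<in> pverts G \<Longrightarrow> y \<in> pverts G \<Longrightarrow> x \<rightarrow>\<^sup>*\<^bsub>with_proj G\<^esub> y"
  using connected reachable_mk_symmetric_eq[OF pair_sym_arcs]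
  by (auto simp: connected_def strongly_connected_def)

lemma d_self: "x \<in> pverts G \<Longrightarrow> d x x = 0"
  using hop_dist_self[of x] by simp

lemma d_adj: "(x, y) \<in> parcs G \<Longrightarrow> v \<in> pverts G \<Longrightarrow> d x v \<le> Suc (d y v)"
  using hop_dist_adj[of x y v] reach wellformed' by force

lemma d_pred:
  assumes "x \<in> pverts G" "v \<in> pverts G" "x \<noteq> v"
  obtains y where "(x, y) \<in> parcs G" "d x v = Suc (d y v)"
  using hop_dist_pred[OF reach[OF assms(1,2)] assms(3)] by auto

lemma d_le_base_ecc: "y \<in> pverts G \<Longrightarrow> d y x \<le> base_ecc x"
  unfolding base_ecc_def by (simp add: pair_finite_verts)

lemma base_ecc_attained: "\<exists>y \<in> pverts G. d y x = base_ecc x"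
proof -
  have "base_ecc x \<in> (\<lambda>y. d y x) ` pverts G"
    unfolding base_ecc_def using root pair_finite_verts by (intro Max_in) auto
  then show ?thesis by force
qed

text \<open>Triangle inequality through the root. If a pendent path is longer than
  \<open>base_ecc w\<close>, its end is therefore farther from \<open>x\<close> than any vertex of
  \<open>G\<close>.\<close>

lemma base_ecc_le:
  assumes "x \<in> pverts G"
  shows "base_ecc x \<le> d w x + base_ecc w"
proof -
  obtain y where y: "y \<in> pverts G" "d y x = base_ecc x"
    using base_ecc_attained by blast
  have "d y x \<le> d y w + d w x"
    using hop_dist_triangle reach y root assms by blast
  then show ?thesis using y d_le_base_ecc[of y w] by simp
qed

section \<open>Arcs of the graph with pendent paths\<close>

text \<open>Index 0 denotes the root on either path, so the arc at the root has the same form as all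
  other path arcs.\<close>

abbreviation path_v :: "nat \<Rightarrow> 'a pendent_vertex" where
  "path_v i \<equiv> if i = 0 then Base w else NewV i"

abbreviation path_u :: "nat \<Rightarrow> 'a pendent_vertex" where
  "path_u i \<equiv> if i = 0 then Base w else NewU i"

lemma parcs_attach_paths:
  "parcs (attach_paths G w p q) = {(Base a, Base b) | a b. (a, b) \<in> parcs G}
    \<union> (\<lambda>i. (path_v i, NewV (Suc i))) ` {..<p} \<union> (\<lambda>i. (NewV (Suc i), path_v i)) ` {..<p}
    \<union> (\<lambda>i. (path_u i, NewU (Suc i))) ` {..<q} \<union> (\<lambda>i. (NewU (Suc i), path_u i)) ` {..<q}"
proof -
  have conv: "((\<lambda>i. (f i, g i)) ` A)\<inverse> = (\<lambda>i. (g i, f i)) ` A"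
    for f g :: "nat \<Rightarrow> 'a pendent_vertex" and A
    by blast
  have map: "map_prod Base Base ` A = {(Base a, Base b) | a b. (a, b) \<in> A}" for A :: "('a \<times> 'a) set"
    by force
  show ?thesis
    unfolding map attach_paths_def Let_def set_vwalk_arcs_pendent_path converse_Un conv
    by (simp only: pair_pre_digraph.simps Un_ac)
qed

lemma attach_arc_cases:
  assumes "(x, y) \<in> parcs (attach_paths G w p q)"
  obtains (base) a b where "x = Base a" "y = Base b" "(a, b) \<in> parcs G"
  | (v_out) i where "x = path_v i" "y = NewV (Suc i)" "i < p"
  | (v_in) i where "x = NewV (Suc i)" "y = path_v i" "i < p"
  | (u_out) i where "x = path_u i" "y = NewU (Suc i)" "i < q"
  | (u_in) i where "x = NewU (Suc i)" "y = path_u i" "i < q"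
  using assms unfolding parcs_attach_paths by blast

lemma attach_arcs:
  "(a, b) \<in> parcs G \<Longrightarrow> (Base a, Base b) \<in> parcs (attach_paths G w p q)"
  "i < p \<Longrightarrow> (path_v i, NewV (Suc i)) \<in> parcs (attach_paths G w p q)"
  "i < p \<Longrightarrow> (NewV (Suc i), path_v i) \<in> parcs (attach_paths G w p q)"
  "i < q \<Longrightarrow> (path_u i, NewU (Suc i)) \<in> parcs (attach_paths G w p q)"
  "i < q \<Longrightarrow> (NewU (Suc i), path_u i) \<in> parcs (attach_paths G w p q)"
  unfolding parcs_attach_paths by blast+

text \<open>Descent condition for a path vertex whose neighbour towards the root is the one closer
  to the target.\<close>

lemma attach_descent_v:
  assumes "1 \<le> i" "i \<le> p" and "D (NewV i) = Suc (D (path_v (i - 1)))"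
  shows "\<exists>y. (NewV i, y) \<in> parcs (attach_paths G w p q) \<and> D (NewV i) = Suc (D y)"
  using attach_arcs(3)[of "i - 1" p q] assms by (intro exI[of _ "path_v (i - 1)"]) simp

lemma attach_descent_u:
  assumes "1 \<le> i" "i \<le> q" and "D (NewU i) = Suc (D (path_u (i - 1)))"
  shows "\<exists>y. (NewU i, y) \<in> parcs (attach_paths G w p q) \<and> D (NewU i) = Suc (D y)"
  using attach_arcs(5)[of "i - 1" q p] assms by (intro exI[of _ "path_u (i - 1)"]) simp

text \<open>
  The distance from each vertex to the target $x$, $v_k$ and $u_k$ respectively. In
  $(i - k) + (k - i)$ one summand is always zero, so it is the absolute difference.
\<close>

fun dist_Base :: "'a \<Rightarrow> 'a pendent_vertex \<Rightarrow> nat" where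
  "dist_Base x (Base y) = d y x"
| "dist_Base x (NewV i) = i + d w x"
| "dist_Base x (NewU i) = i + d w x"

fun dist_NewV :: "nat \<Rightarrow> 'a pendent_vertex \<Rightarrow> nat" where
  "dist_NewV k (Base y) = k + d y w"
| "dist_NewV k (NewV i) = (i - k) + (k - i)"
| "dist_NewV k (NewU i) = k + i"

fun dist_NewU :: "nat \<Rightarrow> 'a pendent_vertex \<Rightarrow> nat" where
  "dist_NewU k (Base y) = k + d y w"
| "dist_NewU k (NewV i) = k + i"
| "dist_NewU k (NewU i) = (i - k) + (k - i)"

section \<open>Eccentricities in the graph with pendent paths\<close>

lemma eccentricity_attach_eqI:
  fixes D :: "'a pendent_vertex \<Rightarrow> nat" and p q :: nat
  defines "H \<equiv> attach_paths G w p q"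
  assumes "D v = 0" "v \<in> pverts H"
    and "\<And>x y. (x, y) \<in> parcs H \<Longrightarrow> D x \<le> Suc (D y)"
    and "\<And>x. x \<in> pverts H \<Longrightarrow> x \<noteq> v \<Longrightarrow> \<exists>y. (x, y) \<in> parcs H \<and> D x = Suc (D y)"
    and "\<And>x. x \<in> pverts H \<Longrightarrow> D x \<le> m"
    and "\<exists>x \<in> pverts H. D x = m"
  shows "eccentricity (with_proj H) v = m"
proof -
  interpret H: pair_graph H
    unfolding H_def using pair_graph_axioms root by (rule pair_graph_attach_paths)
  show ?thesis
    by (rule H.eccentricity_eqI[of D]) (use assms H.pair_finite_verts in auto)
qed

text \<open>A farthest vertex lies in \<open>G\<close> or is the end of the longer path, which is
  reached through \<open>w\<close>.\<close>

lemma eccentricity_Base: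
  assumes x: "x \<in> pverts G"
  shows "eccentricity (attach_paths G w p q) (Base x) = max (base_ecc x) (d w x + max p q)"
proof (rule eccentricity_attach_eqI[of "dist_Base x"])
  let ?H = "attach_paths G w p q"
  show "dist_Base x (Base x) = 0" "Base x \<in> pverts ?H"
    using x by (auto simp: d_self pverts_attach_paths)
  show "dist_Base x y \<le> Suc (dist_Base x z)" if "(y, z) \<in> parcs ?H" for y z
    using that by (cases rule: attach_arc_cases) (auto simp: d_adj x)
  show "\<exists>z. (y, z) \<in> parcs ?H \<and> dist_Base x y = Suc (dist_Base x z)"
    if y: "y \<in> pverts ?H" "y \<noteq> Base x" for y
  proof (cases y)
    case (Base b)
    with y have "b \<in> pverts G" "b \<noteq> x" by (auto simp: pverts_attach_paths)
    then obtain z where "(b, z) \<in> parcs G" "d b x = Suc (d z x)"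
      using d_pred x by metis
    then show ?thesis using Base attach_arcs(1) by fastforce
  next
    case (NewV i)
    with y have "1 \<le> i" "i \<le> p" by (auto simp: pverts_attach_paths)
    then show ?thesis unfolding NewV
      by (intro attach_descent_v[where D = "dist_Base x"]) (auto simp: d_self root)
  next
    case (NewU i)
    with y have "1 \<le> i" "i \<le> q" by (auto simp: pverts_attach_paths)
    then show ?thesis unfolding NewU
      by (intro attach_descent_u[where D = "dist_Base x"]) (auto simp: d_self root)
  qed
  show "dist_Base x y \<le> max (base_ecc x) (d w x + max p q)" if "y \<in> pverts ?H" for y
    using that d_le_base_ecc by (auto simp: pverts_attach_paths le_max_iff_disj)
  obtain y where y: "y \<in> pverts G" "d y x = base_ecc x"
    using base_ecc_attained by blast
  \<comment> \<open>If both paths are empty, this inequality forces the first case below. In the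
    other two cases the longer path is therefore nonempty and its end is a vertex.\<close>
  have wx: "d w x \<le> base_ecc x" using root by (rule d_le_base_ecc)
  consider "d w x + max p q \<le> base_ecc x" | "p \<ge> q" "p \<ge> 1" "d w x + max p q > base_ecc x"
    | "q \<ge> p" "q \<ge> 1" "d w x + max p q > base_ecc x" using wx by linarith
  then show "\<exists>y\<in>pverts ?H. dist_Base x y = max (base_ecc x) (d w x + max p q)"
  proof cases
    case 1
    then show ?thesis using y by (intro bexI[of _ "Base y"]) (auto simp: pverts_attach_paths)
  next
    case 2
    then show ?thesis by (intro bexI[of _ "NewV p"]) (auto simp: pverts_attach_paths)
  next
    case 3
    then show ?thesis by (intro bexI[of _ "NewU q"]) (auto simp: pverts_attach_paths)
  qed
qed

text \<open>From \<open>NewV k\<close>, all of \<open>G\<close> and the other path are reached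
  through \<open>w\<close>, after \<open>k\<close> steps; this gives the first term. The second is
  the distance to the outer end of its own path. Vertices between \<open>w\<close> and
  \<open>NewV k\<close> are closer than \<open>w\<close>.\<close>

lemma eccentricity_NewV:
  assumes k: "1 \<le> k" "k \<le> p"
  shows "eccentricity (attach_paths G w p q) (NewV k) = max (k + max (base_ecc w) q) (p - k)"
proof (rule eccentricity_attach_eqI[of "dist_NewV k"])
  let ?H = "attach_paths G w p q"
  show "dist_NewV k (NewV k) = 0" "NewV k \<in> pverts ?H"
    using k by (auto simp: pverts_attach_paths)
  show "dist_NewV k y \<le> Suc (dist_NewV k z)" if "(y, z) \<in> parcs ?H" for y z
    using that k by (cases rule: attach_arc_cases) (auto simp: d_adj d_self root)
  show "\<exists>z. (y, z) \<in> parcs ?H \<and> dist_NewV k y = Suc (dist_NewV k z)"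
    if y: "y \<in> pverts ?H" "y \<noteq> NewV k" for y
  proof (cases y)
    case (Base b)
    show ?thesis
    proof (cases "b = w")
      case True
      then show ?thesis using Base k attach_arcs(2)[of 0 p q] root
        by (intro exI[of _ "NewV 1"]) (auto simp: d_self)
    next
      case False
      with y Base have "b \<in> pverts G" by (auto simp: pverts_attach_paths)
      then obtain z where "(b, z) \<in> parcs G" "d b w = Suc (d z w)"
        using d_pred root False by metis
      then show ?thesis using Base attach_arcs(1) by fastforce
    qed
  next
    case (NewV i)
    with y have i: "1 \<le> i" "i \<le> p" "i \<noteq> k" by (auto simp: pverts_attach_paths)
    show ?thesis
    \<comment> \<open>Below position \<open>k\<close> the neighbour away from the root is closer to
      the target; above it, the neighbour towards the root is.\<close>
    proof (cases "i < k")
      case True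
      then show ?thesis using NewV i k attach_arcs(2)[of i p q]
        by (intro exI[of _ "NewV (Suc i)"]) auto
    next
      case False
      then show ?thesis unfolding NewV using i k
        by (intro attach_descent_v[where D = "dist_NewV k"]) auto
    qed
  next
    case (NewU i)
    with y have "1 \<le> i" "i \<le> q" by (auto simp: pverts_attach_paths)
    then show ?thesis unfolding NewU
      by (intro attach_descent_u[where D = "dist_NewV k"]) (auto simp: d_self root)
  qed
  show "dist_NewV k y \<le> max (k + max (base_ecc w) q) (p - k)" if "y \<in> pverts ?H" for y
    using that d_le_base_ecc k by (auto simp: pverts_attach_paths le_max_iff_disj)
  obtain y where y: "y \<in> pverts G" "d y w = base_ecc w"
    using base_ecc_attained by blast
  \<comment> \<open>Here \<open>q\<close> may be 0. The strict inequality in the third case ensures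
    that \<open>NewU q\<close> is a vertex.\<close>
  consider "k + max (base_ecc w) q \<le> p - k" | "base_ecc w \<ge> q" "k + max (base_ecc w) q > p - k"
    | "q > base_ecc w" "k + max (base_ecc w) q > p - k" by linarith
  then show "\<exists>y\<in>pverts ?H. dist_NewV k y = max (k + max (base_ecc w) q) (p - k)"
  proof cases
    case 1
    then show ?thesis using k by (intro bexI[of _ "NewV p"]) (auto simp: pverts_attach_paths)
  next
    case 2
    then show ?thesis using y by (intro bexI[of _ "Base y"]) (auto simp: pverts_attach_paths)
  next
    case 3
    then show ?thesis by (intro bexI[of _ "NewU q"]) (auto simp: pverts_attach_paths)
  qed
qed

text \<open>The argument for \<open>eccentricity_NewV\<close> with the two paths exchanged.\<close>

lemma eccentricity_NewU:
  assumes k: "1 \<le> k" "k \<le> q"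
  shows "eccentricity (attach_paths G w p q) (NewU k) = max (k + max (base_ecc w) p) (q - k)"
proof (rule eccentricity_attach_eqI[of "dist_NewU k"])
  let ?H = "attach_paths G w p q"
  show "dist_NewU k (NewU k) = 0" "NewU k \<in> pverts ?H"
    using k by (auto simp: pverts_attach_paths)
  show "dist_NewU k y \<le> Suc (dist_NewU k z)" if "(y, z) \<in> parcs ?H" for y z
    using that k by (cases rule: attach_arc_cases) (auto simp: d_adj d_self root)
  show "\<exists>z. (y, z) \<in> parcs ?H \<and> dist_NewU k y = Suc (dist_NewU k z)"
    if y: "y \<in> pverts ?H" "y \<noteq> NewU k" for y
  proof (cases y)
    case (Base b)
    show ?thesis
    proof (cases "b = w")
      case True
      then show ?thesis using Base k attach_arcs(4)[of 0 q p] root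
        by (intro exI[of _ "NewU 1"]) (auto simp: d_self)
    next
      case False
      with y Base have "b \<in> pverts G" by (auto simp: pverts_attach_paths)
      then obtain z where "(b, z) \<in> parcs G" "d b w = Suc (d z w)"
        using d_pred root False by metis
      then show ?thesis using Base attach_arcs(1) by fastforce
    qed
  next
    case (NewU i)
    with y have i: "1 \<le> i" "i \<le> q" "i \<noteq> k" by (auto simp: pverts_attach_paths)
    show ?thesis
    proof (cases "i < k")
      case True
      then show ?thesis using NewU i k attach_arcs(4)[of i q p]
        by (intro exI[of _ "NewU (Suc i)"]) auto
    next
      case False
      then show ?thesis unfolding NewU using i k
        by (intro attach_descent_u[where D = "dist_NewU k"]) auto
    qed
  next
    case (NewV i)
    with y have "1 \<le> i" "i \<le> p" by (auto simp: pverts_attach_paths)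
    then show ?thesis unfolding NewV
      by (intro attach_descent_v[where D = "dist_NewU k"]) (auto simp: d_self root)
  qed
  show "dist_NewU k y \<le> max (k + max (base_ecc w) p) (q - k)" if "y \<in> pverts ?H" for y
    using that d_le_base_ecc k by (auto simp: pverts_attach_paths le_max_iff_disj)
  obtain y where y: "y \<in> pverts G" "d y w = base_ecc w"
    using base_ecc_attained by blast
  consider "k + max (base_ecc w) p \<le> q - k" | "base_ecc w \<ge> p" "k + max (base_ecc w) p > q - k"
    | "p > base_ecc w" "k + max (base_ecc w) p > q - k" by linarith
  then show "\<exists>y\<in>pverts ?H. dist_NewU k y = max (k + max (base_ecc w) p) (q - k)"
  proof cases
    case 1
    then show ?thesis using k by (intro bexI[of _ "NewU q"]) (auto simp: pverts_attach_paths)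
  next
    case 2
    then show ?thesis using y by (intro bexI[of _ "Base y"]) (auto simp: pverts_attach_paths)
  next
    case 3
    then show ?thesis by (intro bexI[of _ "NewV p"]) (auto simp: pverts_attach_paths)
  qed
qed

lemmas attach_eccentricity = eccentricity_Base eccentricity_NewV eccentricity_NewU

section \<open>Comparison of the two graphs\<close>

lemma ex_eccentricity_increasing_bij:
  assumes "2 \<le> card (pverts G)" "p \<ge> q" "q \<ge> 1"
  defines "H \<equiv> attach_paths G w p q" and "H' \<equiv> attach_paths G w (p + 1) (q - 1)"
  shows "\<exists>h. bij_betw h (pverts H) (pverts H') \<and>
    (\<forall>x\<in>pverts H. eccentricity H x \<le> eccentricity H' (h x)) \<and>
    (\<exists>x\<in>pverts H. eccentricity H x < eccentricity H' (h x))"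
proof (cases "q \<le> base_ecc w")
  case True
  define h :: "'a pendent_vertex \<Rightarrow> 'a pendent_vertex"
    where "h = id(NewU q := NewV (p + 1))"
  define g :: "'a pendent_vertex \<Rightarrow> 'a pendent_vertex"
    where "g = id(NewV (p + 1) := NewU q)"
  have "bij_betw h (pverts H) (pverts H')"
    by (rule bij_betw_byWitness[of _ g])
      (use assms(3) in \<open>auto simp: h_def g_def H_def H'_def pverts_attach_paths image_iff\<close>)
  moreover have "eccentricity H x \<le> eccentricity H' (h x)" if "x \<in> pverts H" for x
  proof (cases "x = NewU q")
    case True
    then show ?thesis
      using \<open>q \<le> base_ecc w\<close> assms(2,3) by (simp add: H_def H'_def h_def attach_eccentricity)
  next
    \<comment> \<open>Lengthening the first path lowers no eccentricity. Shortening the second does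
      no harm to a fixed vertex: on the first path, \<open>max (base_ecc w) q\<close> equals
      \<open>base_ecc w\<close> before and after; on the second, \<open>q - i\<close> is dominated
      by \<open>i + base_ecc w\<close>; and in \<open>G\<close> only the longer path
      matters.\<close>
    case False
    with that consider (b) a where "x = Base a" "a \<in> pverts G"
      | (v) i where "x = NewV i" "1 \<le> i" "i \<le> p" | (u) i where "x = NewU i" "1 \<le> i" "i < q"
      by (force simp: H_def pverts_attach_paths)
    then show ?thesis
      by cases (use \<open>q \<le> base_ecc w\<close> assms(2,3) in
        \<open>auto simp: H_def H'_def h_def attach_eccentricity\<close>)
  qed
  \<comment> \<open>With e for \<open>base_ecc w\<close>, the values are q + max(e, p) and p + 1 +
    e. The latter is larger because q \<le> p handles the maximum e, and q \<le> e handles the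
    maximum p.\<close>
  moreover have "eccentricity H (NewU q) < eccentricity H' (h (NewU q))"
    using assms(2,3) True by (simp add: H_def H'_def h_def attach_eccentricity)
  moreover have "NewU q \<in> pverts H" using assms(3) by (simp add: H_def pverts_attach_paths)
  ultimately show ?thesis by blast
next
  case False
  \<comment> \<open>The shift moves towards the end of the first path: \<open>NewU 1\<close> takes
    the place of \<open>w\<close>, and \<open>w\<close> moves to \<open>NewV 1\<close>. As one path
    grows and the other shrinks by one, every vertex of the long path keeps its distances to both
    ends.\<close>
  define h where "h x = (case x of Base a \<Rightarrow> if a = w then NewV 1 else Base a
      | NewV i \<Rightarrow> NewV (Suc i) | NewU j \<Rightarrow> if j = 1 then Base w else NewU (j - 1))" for x
  define g where "g x = (case x of Base a \<Rightarrow> if a = w then NewU 1 else Base a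
      | NewV i \<Rightarrow> if i = 1 then Base w else NewV (i - 1) | NewU j \<Rightarrow> NewU (Suc j))" for x
  have "bij_betw h (pverts H) (pverts H')"
  proof (rule bij_betw_byWitness[of _ g])
    show "\<forall>x\<in>pverts H. g (h x) = x" "\<forall>x\<in>pverts H'. h (g x) = x"
      by (auto simp: h_def g_def H_def H'_def pverts_attach_paths)
    have "h x \<in> pverts H'" if "x \<in> pverts H" for x
      using that assms(3) root
      by (cases x) (auto simp: h_def H_def H'_def in_pverts_attach_paths)
    then show "h ` pverts H \<subseteq> pverts H'" by blast
    have "g x \<in> pverts H" if "x \<in> pverts H'" for x
      using that assms(3) root
      by (cases x) (auto simp: g_def H_def H'_def in_pverts_attach_paths)
    then show "g ` pverts H' \<subseteq> pverts H" by blast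
  qed
  \<comment> \<open>On the long path these are equalities. Since \<open>base_ecc w\<close> is at
    most \<open>q - 1\<close>, even the shortened path reaches at least as far from \<open>w\<close>
    as \<open>G\<close> does, so \<open>G\<close> does not affect the maxima.\<close>
  moreover have "eccentricity H x \<le> eccentricity H' (h x)" if "x \<in> pverts H" for x
  proof -
    consider (w) "x = Base w" | (b) a where "x = Base a" "a \<in> pverts G" "a \<noteq> w"
      | (v) i where "x = NewV i" "1 \<le> i" "i \<le> p"
      | (u1) "x = NewU 1" | (u) i where "x = NewU i" "1 < i" "i \<le> q"
      using \<open>x \<in> pverts H\<close> by (force simp: H_def pverts_attach_paths)
    then show ?thesis
      by cases (use False assms(2,3) root d_self[of w] in
        \<open>auto simp: H_def H'_def h_def attach_eccentricity\<close>)
  qed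
  moreover obtain x where x: "x \<in> pverts G" "x \<noteq> w"
  proof -
    have "\<not> pverts G \<subseteq> {w}"
      using assms(1) card_mono[of "{w}" "pverts G"] by auto
    then show ?thesis using that by blast
  qed
  \<comment> \<open>By \<open>base_ecc_le\<close> and \<open>base_ecc w < q\<close>, the end of the
    first path is farthest from \<open>x\<close> in both graphs, so the eccentricity rises from
    \<open>d w x + p\<close> to \<open>d w x + p + 1\<close>.\<close>
  moreover have "eccentricity H (Base x) < eccentricity H' (h (Base x))"
    using assms(2,3) False x base_ecc_le[OF x(1)]
    by (simp add: H_def H'_def h_def attach_eccentricity)
  moreover have "Base x \<in> pverts H" using x by (simp add: H_def pverts_attach_paths)
  ultimately show ?thesis by blast
qed

end

theorem mainTheorem1:
  fixes G :: "'a pair_pre_digraph" and w :: 'a and p q :: nat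
  assumes "pair_graph G"
    and "connected G"
    and "2 \<le> card (pverts G)"
    and "w \<in> pverts G"
    and "p \<ge> q" and "q \<ge> 1"
  shows "ecc (attach_paths G w p q) < ecc (attach_paths G w (p + 1) (q - 1))"
proof -
  interpret pair_graph G by fact
  interpret rooted_graph G w by unfold_locales fact+
  let ?H = "attach_paths G w p q" and ?H' = "attach_paths G w (p + 1) (q - 1)"
  obtain h where h: "bij_betw h (pverts ?H) (pverts ?H')"
    "\<And>x. x \<in> pverts ?H \<Longrightarrow> eccentricity ?H x \<le> eccentricity ?H' (h x)"
    "\<exists>x\<in>pverts ?H. eccentricity ?H x < eccentricity ?H' (h x)"
    using ex_eccentricity_increasing_bij[OF assms(3,5,6)] by blast
  have fin: "finite (pverts ?H)" and ne: "pverts ?H \<noteq> {}"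
    using assms(4) pair_finite_verts by (auto simp: pverts_attach_paths)
  have "sum (eccentricity ?H) (pverts ?H) < sum (eccentricity ?H') (pverts ?H')"
    using sum_strict_mono_bij[OF fin h] .
  moreover have "card (pverts ?H) = card (pverts ?H')"
    using h(1) by (rule bij_betw_same_card)
  moreover have "card (pverts ?H) > 0" using fin ne by (simp add: card_gt_0_iff)
  ultimately show ?thesis by (simp add: ecc_def divide_strict_right_mono)
qed

end
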